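(* Let $(G_m,S)$ be a Coxeter system with a countably infinite, arbitrarily enumerated set $S=\{s_1,s_2,s_3,\ldots\}$ of generators (the $s_i$ pairwise distinct) and Coxeter matrix $m$. Assume that $m(s,s')\geq 3$ for all $s,s'\in S$ with $s\neq s'$ (the value $\infty$ being allowed). Then for all $k\in\mathbb{N}$ \[ \lim_{N\rightarrow\infty}\varphi\left(\left(\frac{\delta(s_1)+\ldots+\delta(s_N)}{\sqrt{N}}\right)^k\right)=\begin{cases}0 & \text{if } k \text{ is odd},\\[4pt] \dfrac{1}{n+1}\dbinom{2n}{n} & \text{if } k=2n \text{ is even}.\end{cases} \]
   Context: A Coxeter matrix over a set $S$ is a symmetric function $m:S\times S\to\mathbb{N}\cup\{\infty\}$ with $m(s,s)=1$ and $m(s,s')\geq 2$ for $s\neq s'$. The corresponding Coxeter group $G_m$ is the group with generating set $S$ and defining relations $(ss')^{m(s,s')}=\mathrm{Id}$ for all $s,s'\in S$ with $m(s,s')<\infty$ (for infinite $S$ it is the inductive limit of the Coxeter groups $W_J$ of the restrictions of $m$ to finite subsets $J\subset S$). The group algebra $\mathbb{C}G_m$ consists of finite formal sums $\sum_{x\in G_m}a_x\delta(x)$ with convolution product determined by $\delta(x)\delta(y)=\delta(xy)$. The canonical trace $\varphi:\mathbb{C}G_m\to\mathbb{C}$ is $\varphi\left(\sum_{x}a_x\delta(x)\right)=a_{\mathrm{Id}}$, the coefficient at the identity. *)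

theory Defs
  imports Complex_Main "HOL-Library.Extended_Nat" "HOL-Algebra.Module"
begin

text \<open>
  A word is a list of signed letters: \<open>(s, True)\<close> stands for \<open>s\<close> and \<open>(s, False)\<close> for the
  formal inverse of \<open>s\<close>.  The group with generating set \<open>S\<close> and relators \<open>R\<close> (a set of words
  over \<open>S\<close>) consists of the words over \<open>S\<close> modulo the congruence generated by free cancellation
  and by equating all relators with the empty word.
\<close>

type_synonym 'a word = "('a \<times> bool) list"

definition words :: "'a set \<Rightarrow> 'a word set" where
  "words S = lists (S \<times> UNIV)"

inductive_set pres_rel :: "'a set \<Rightarrow> 'a word set \<Rightarrow> ('a word \<times> 'a word) set"
  for S :: "'a set" and R :: "'a word set" where
  cancel: "u \<in> words S \<Longrightarrow> v \<in> words S \<Longrightarrow> s \<in> S \<Longrightarrow>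
             (u @ [(s, b), (s, \<not> b)] @ v, u @ v) \<in> pres_rel S R"
| relator: "u \<in> words S \<Longrightarrow> v \<in> words S \<Longrightarrow> r \<in> R \<Longrightarrow> (u @ r @ v, u @ v) \<in> pres_rel S R"
| refl: "u \<in> words S \<Longrightarrow> (u, u) \<in> pres_rel S R"
| sym: "(u, v) \<in> pres_rel S R \<Longrightarrow> (v, u) \<in> pres_rel S R"
| trans: "(u, v) \<in> pres_rel S R \<Longrightarrow> (v, w) \<in> pres_rel S R \<Longrightarrow> (u, w) \<in> pres_rel S R"

definition presented_group :: "'a set \<Rightarrow> 'a word set \<Rightarrow> 'a word set monoid" where
  "presented_group S R =
     \<lparr>carrier = words S // pres_rel S R,
      monoid.mult = (\<lambda>A B. \<Union>u\<in>A. \<Union>v\<in>B. pres_rel S R `` {u @ v}),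
      one = pres_rel S R `` {[]}\<rparr>"

definition coxeter_matrix :: "'a set \<Rightarrow> ('a \<Rightarrow> 'a \<Rightarrow> enat) \<Rightarrow> bool" where
  "coxeter_matrix S m \<longleftrightarrow>
     (\<forall>s\<in>S. \<forall>t\<in>S. m s t = m t s) \<and>
     (\<forall>s\<in>S. m s s = 1) \<and>
     (\<forall>s\<in>S. \<forall>t\<in>S. s \<noteq> t \<longrightarrow> m s t \<ge> 2)"

definition coxeter_relators :: "'a set \<Rightarrow> ('a \<Rightarrow> 'a \<Rightarrow> enat) \<Rightarrow> 'a word set" where
  "coxeter_relators S m =
     {concat (replicate n [(s, True), (t, True)]) | s t n. s \<in> S \<and> t \<in> S \<and> m s t = enat n}"

definition coxeter_group :: "'a set \<Rightarrow> ('a \<Rightarrow> 'a \<Rightarrow> enat) \<Rightarrow> 'a word set monoid" where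
  "coxeter_group S m = presented_group S (coxeter_relators S m)"

definition coxeter_gen :: "'a set \<Rightarrow> ('a \<Rightarrow> 'a \<Rightarrow> enat) \<Rightarrow> 'a \<Rightarrow> 'a word set" where
  "coxeter_gen S m s = pres_rel S (coxeter_relators S m) `` {[(s, True)]}"

definition delta :: "'g \<Rightarrow> 'g \<Rightarrow> complex" where
  "delta x = (\<lambda>y. if y = x then 1 else 0)"

text \<open>
  A finite formal sum of group elements is represented by its coefficient function, which vanishes
  outside the carrier.
\<close>

definition group_algebra :: "('g, 'r) monoid_scheme \<Rightarrow> (complex, 'g \<Rightarrow> complex) module" where
  "group_algebra G =
     \<lparr>carrier = {f. finite {x. f x \<noteq> 0} \<and> {x. f x \<noteq> 0} \<subseteq> carrier G},
      monoid.mult = (\<lambda>f g z. \<Sum>(x, y) | f x \<noteq> 0 \<and> g y \<noteq> 0 \<and> x \<otimes>\<^bsub>G\<^esub> y = z. f x * g y),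
      one = delta \<one>\<^bsub>G\<^esub>,
      zero = (\<lambda>x. 0),
      add = (\<lambda>f g x. f x + g x),
      smult = (\<lambda>c f x. c * f x)\<rparr>"

definition canonical_trace :: "('g, 'r) monoid_scheme \<Rightarrow> ('g \<Rightarrow> complex) \<Rightarrow> complex" where
  "canonical_trace G f = f \<one>\<^bsub>G\<^esub>"

end

theory Submission
  imports Defs
begin

text \<open>
  Expanding the power turns the trace into \<open>N^(-k/2)\<close> times the number of words of length \<open>k\<close> over
  \<open>s\<^sub>1, \<dots>, s\<^sub>N\<close> that represent the identity (\<open>trace_power_generator_sum\<close>), so everything is a
  question of which words are trivial in the group.

  That is decided by the geometric representation, used here in its dual form: the generator \<open>s\<close>
  sends a function \<open>f\<close> on \<open>S\<close> to \<open>f + f(s) \<cdot> weight s\<close>, where \<open>weight s t = 2 cos (\<pi> / m(s,t))\<close>.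
  This form involves no sums over \<open>S\<close>, so infinite \<open>S\<close> needs no special care.  The indicator
  function of a letter \<open>x\<close> is fixed by all other generators and moved by \<open>x\<close>; hence in a trivial word
  no letter occurs exactly once (\<open>single_occurrence_not_trivial\<close>).  If all \<open>m(s,t) \<ge> 3\<close> for
  \<open>s \<noteq> t\<close>, the off-diagonal weights are strictly positive.  Then a trivial word cannot contain exactly
  two occurrences of \<open>x\<close> that enclose a nonempty word of distinct letters: reflecting in these letters
  strictly increases the value at \<open>x\<close>, whereas triviality would require it to stay the same
  (\<open>crossing_not_trivial\<close>).

  Consequently the trivial words of length \<open>k\<close> fall into two groups.  Those with some letter occurring
  at least three times use fewer than \<open>k/2\<close> letters, so there are only \<open>O(N^((k-1)/2))\<close> of them.  In
  the others every letter that occurs does so exactly twice, and a word of this kind is trivial exactly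
  when its pairs of equal letters do not cross.  Read from left to right, it is the history of a
  stack: every letter either is new and is pushed, or equals the top of the stack and is popped.  The
  stack heights form a Dyck path of length \<open>k = 2n\<close>, and the \<open>n\<close> pushes admit \<open>N(N-1)\<cdots>(N-n+1)\<close>
  choices of letters.  So the number of these words is this product times the Catalan number, which
  is the case of height zero of the ballot numbers (\<open>closing_count_ballot\<close>); division by \<open>N^n\<close> gives
  the limit.
\<close>

section \<open>Multiplying classes of words\<close>

lemma words_append [simp]: "u @ v \<in> words S \<longleftrightarrow> u \<in> words S \<and> v \<in> words S"
  by (auto simp: words_def)

lemma words_Cons [simp]: "l # u \<in> words S \<longleftrightarrow> fst l \<in> S \<and> u \<in> words S"
  by (cases l) (auto simp: words_def)

lemma words_Nil [simp]: "[] \<in> words S"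
  by (simp add: words_def)

lemma pres_rel_words:
  assumes "(u, v) \<in> pres_rel S R" "R \<subseteq> words S"
  shows "u \<in> words S \<and> v \<in> words S"
  using assms by (induction rule: pres_rel.induct) (auto simp: words_def)

lemma equiv_pres_rel:
  assumes "R \<subseteq> words S"
  shows "equiv (words S) (pres_rel S R)"
proof (rule equivI)
  show "pres_rel S R \<subseteq> words S \<times> words S"
    using pres_rel_words[OF _ assms] by auto
  show "refl_on (words S) (pres_rel S R)"
    by (rule refl_onI) (auto intro: pres_rel.refl)
  show "sym (pres_rel S R)"
    by (rule symI) (rule pres_rel.sym)
  show "trans (pres_rel S R)"
    by (rule transI) (rule pres_rel.trans)
qed

lemma pres_rel_context:
  assumes "(u, v) \<in> pres_rel S R" "p \<in> words S" "q \<in> words S"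
  shows "(p @ u @ q, p @ v @ q) \<in> pres_rel S R"
  using assms
proof (induction rule: pres_rel.induct)
  case (cancel u v s b)
  then show ?case
    using pres_rel.cancel[of "p @ u" S "v @ q" s b R] by simp
next
  case (relator u v r)
  then show ?case
    using pres_rel.relator[of "p @ u" S "v @ q" r R] by simp
next
  case (refl u)
  then show ?case by (intro pres_rel.refl) simp
next
  case (sym u v)
  show ?case by (rule pres_rel.sym[OF sym.IH[OF sym.prems]])
next
  case (trans u v w)
  show ?case by (rule pres_rel.trans[OF trans.IH(1)[OF trans.prems] trans.IH(2)[OF trans.prems]])
qed

lemma pres_rel_append:
  assumes "(u, u') \<in> pres_rel S R" "(v, v') \<in> pres_rel S R" "R \<subseteq> words S"
  shows "(u @ v, u' @ v') \<in> pres_rel S R"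
proof (rule pres_rel.trans)
  show "(u @ v, u' @ v) \<in> pres_rel S R"
    using pres_rel_context[OF assms(1), of "[]" v] pres_rel_words[OF assms(2,3)] by simp
  show "(u' @ v, u' @ v') \<in> pres_rel S R"
    using pres_rel_context[OF assms(2), of u' "[]"] pres_rel_words[OF assms(1,3)] by simp
qed

lemma presented_group_mult_class:
  assumes "u \<in> words S" "v \<in> words S" "R \<subseteq> words S"
  shows "pres_rel S R `` {u} \<otimes>\<^bsub>presented_group S R\<^esub> pres_rel S R `` {v}
           = pres_rel S R `` {u @ v}"
proof -
  have eq: "pres_rel S R `` {u' @ v'} = pres_rel S R `` {u @ v}"
    if "u' \<in> pres_rel S R `` {u}" "v' \<in> pres_rel S R `` {v}" for u' v'
    using that pres_rel_append[OF _ _ assms(3)]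
    by (intro equiv_class_eq[OF equiv_pres_rel[OF assms(3)], symmetric]) simp
  have "(\<Union>u'\<in>pres_rel S R `` {u}. \<Union>v'\<in>pres_rel S R `` {v}. pres_rel S R `` {u' @ v'})
      = (\<Union>u'\<in>pres_rel S R `` {u}. \<Union>v'\<in>pres_rel S R `` {v}. pres_rel S R `` {u @ v})"
    by (intro SUP_cong[OF HOL.refl]) (rule eq)
  also have "\<dots> = pres_rel S R `` {u @ v}"
  proof -
    have "u \<in> pres_rel S R `` {u}" "v \<in> pres_rel S R `` {v}"
      using assms(1,2) by (simp_all add: pres_rel.refl)
    then show ?thesis by blast
  qed
  finally show ?thesis
    by (simp add: presented_group_def)
qed

section \<open>Sums of point masses in the group algebra\<close>

text \<open>
  The laws of the additive monoid are what allows finite sums in the algebra to be evaluated pointwise.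
\<close>

lemma group_algebra_abelian_monoid: "abelian_monoid (group_algebra G)"
proof (rule abelian_monoidI, goal_cases)
  case (1 f g)
  have "{x. f x + g x \<noteq> 0} \<subseteq> {x. f x \<noteq> 0} \<union> {x. g x \<noteq> 0}" by auto
  with 1 show ?case
    by (auto simp: group_algebra_def intro: finite_subset)
qed (auto simp: group_algebra_def add_ac)

lemma finsum_delta:
  assumes "finite J" "q ` J \<subseteq> carrier G"
  shows "(\<Oplus>\<^bsub>group_algebra G\<^esub>j\<in>J. delta (q j)) = (\<lambda>z. \<Sum>j\<in>J. delta (q j) z)"
  using assms
proof (induction J rule: finite_induct)
  case empty
  interpret abelian_monoid "group_algebra G" by (rule group_algebra_abelian_monoid)
  show ?case by (simp add: finsum_empty) (simp add: group_algebra_def)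
next
  case (insert j J)
  interpret abelian_monoid "group_algebra G" by (rule group_algebra_abelian_monoid)
  have "delta x \<in> carrier (group_algebra G)" if "x \<in> carrier G" for x
    using that by (auto simp: group_algebra_def delta_def)
  then have "(\<Oplus>\<^bsub>group_algebra G\<^esub>i\<in>insert j J. delta (q i))
      = delta (q j) \<oplus>\<^bsub>group_algebra G\<^esub> (\<Oplus>\<^bsub>group_algebra G\<^esub>i\<in>J. delta (q i))"
    using insert by (intro finsum_insert) auto
  with insert show ?case by (simp add: group_algebra_def)
qed

text \<open>
  Convolution is bilinear and \<open>\<delta>(x) \<delta>(y) = \<delta>(xy)\<close>.  Neither \<open>p\<close> nor \<open>q\<close> has to be injective, so that sums over
  words can be multiplied without knowing which words represent the same group element.
\<close>

lemma convolution_delta_sums: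
  assumes "finite I" "finite J"
  shows "(\<lambda>x. \<Sum>i\<in>I. c * delta (p i) x) \<otimes>\<^bsub>group_algebra G\<^esub> (\<lambda>y. \<Sum>j\<in>J. d * delta (q j) y)
           = (\<lambda>z. \<Sum>(i, j)\<in>I \<times> J. c * d * delta (p i \<otimes>\<^bsub>G\<^esub> q j) z)"
    (is "?f \<otimes>\<^bsub>_\<^esub> ?g = _")
proof
  fix z
  have f0: "?f x = 0" if "x \<notin> p ` I" for x
    using that by (intro sum.neutral) (auto simp: delta_def)
  have g0: "?g x = 0" if "x \<notin> q ` J" for x
    using that by (intro sum.neutral) (auto simp: delta_def)
  have pt: "(\<Sum>(x, y)\<in>p ` I \<times> q ` J. delta (x \<otimes>\<^bsub>G\<^esub> y) z * (delta (p i) x * delta (q j) y))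
              = delta (p i \<otimes>\<^bsub>G\<^esub> q j) z" if "i \<in> I" "j \<in> J" for i j
  proof -
    have "(\<Sum>(x, y)\<in>p ` I \<times> q ` J. delta (x \<otimes>\<^bsub>G\<^esub> y) z * (delta (p i) x * delta (q j) y))
        = (\<Sum>xy\<in>p ` I \<times> q ` J. if xy = (p i, q j) then delta (p i \<otimes>\<^bsub>G\<^esub> q j) z else 0)"
      by (intro sum.cong) (auto simp: delta_def split: if_splits)
    then show ?thesis
      using that assms by (simp add: sum.delta)
  qed
  have expand: "delta (x \<otimes>\<^bsub>G\<^esub> y) z * (?f x * ?g y) = (\<Sum>(i, j)\<in>I \<times> J.
      c * d * (delta (x \<otimes>\<^bsub>G\<^esub> y) z * (delta (p i) x * delta (q j) y)))" for x y
  proof -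
    have "?f x * ?g y = (\<Sum>(i, j)\<in>I \<times> J. (c * delta (p i) x) * (d * delta (q j) y))"
      by (simp only: sum_product sum.cartesian_product)
    then show ?thesis
      by (simp add: sum_distrib_left case_prod_unfold mult_ac)
  qed
  have "(?f \<otimes>\<^bsub>group_algebra G\<^esub> ?g) z
      = (\<Sum>(x, y) | ?f x \<noteq> 0 \<and> ?g y \<noteq> 0 \<and> x \<otimes>\<^bsub>G\<^esub> y = z. ?f x * ?g y)"
    by (simp add: group_algebra_def)
  \<comment> \<open>The support of a factor may be smaller than the set of its points because of cancellation;
      summing over all points makes the index set independent of the coefficients.\<close>
  also have "\<dots> = (\<Sum>(x, y)\<in>p ` I \<times> q ` J. delta (x \<otimes>\<^bsub>G\<^esub> y) z * (?f x * ?g y))"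
  proof (rule sum.mono_neutral_cong_left)
    show "finite (p ` I \<times> q ` J)" using assms by simp
    show "{(x, y). ?f x \<noteq> 0 \<and> ?g y \<noteq> 0 \<and> x \<otimes>\<^bsub>G\<^esub> y = z} \<subseteq> p ` I \<times> q ` J"
      using f0 g0 by blast
  qed (auto simp: delta_def split: if_splits)
  also have "\<dots> = (\<Sum>(x, y)\<in>p ` I \<times> q ` J. \<Sum>(i, j)\<in>I \<times> J.
                    c * d * (delta (x \<otimes>\<^bsub>G\<^esub> y) z * (delta (p i) x * delta (q j) y)))"
    by (simp only: expand)
  also have "\<dots> = (\<Sum>(i, j)\<in>I \<times> J. c * d *
      (\<Sum>(x, y)\<in>p ` I \<times> q ` J. delta (x \<otimes>\<^bsub>G\<^esub> y) z * (delta (p i) x * delta (q j) y)))"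
    by (simp add: case_prod_unfold sum_distrib_left) (rule sum.swap)
  also have "\<dots> = (\<Sum>(i, j)\<in>I \<times> J. c * d * delta (p i \<otimes>\<^bsub>G\<^esub> q j) z)"
    using pt by (intro sum.cong HOL.refl) auto
  finally show "(?f \<otimes>\<^bsub>group_algebra G\<^esub> ?g) z
      = (\<Sum>(i, j)\<in>I \<times> J. c * d * delta (p i \<otimes>\<^bsub>G\<^esub> q j) z)" .
qed

section \<open>The dual of the geometric representation\<close>

definition letters :: "'a list \<Rightarrow> 'a word" where
  "letters w = map (\<lambda>x. (x, True)) w"

lemma letters_append [simp]: "letters (u @ v) = letters u @ letters v"
  by (simp add: letters_def)

lemma letters_simps [simp]: "letters [] = []" "letters (x # w) = (x, True) # letters w"
  by (simp_all add: letters_def)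

lemma letters_in_words [simp]: "letters w \<in> words S \<longleftrightarrow> set w \<subseteq> S"
  by (induction w) (auto simp: letters_def words_def)

locale coxeter_presentation =
  fixes S :: "'a set" and m :: "'a \<Rightarrow> 'a \<Rightarrow> enat"
  assumes coxeter: "coxeter_matrix S m"
begin

abbreviation rel :: "('a word \<times> 'a word) set" where
  "rel \<equiv> pres_rel S (coxeter_relators S m)"

definition trivial :: "'a list \<Rightarrow> bool" where
  "trivial w \<longleftrightarrow> (letters w, []) \<in> rel"

text \<open>
  \<open>weight s t\<close> is \<open>-2\<close> times the canonical bilinear form at the simple roots of \<open>s\<close> and \<open>t\<close>; on
  the diagonal, where \<open>m s s = 1\<close>, the formula gives \<open>2 cos \<pi> = -2\<close>.
\<close>

definition weight :: "'a \<Rightarrow> 'a \<Rightarrow> real" where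
  "weight s t = (case m s t of enat n \<Rightarrow> 2 * cos (pi / real n) | \<infinity> \<Rightarrow> 2)"

text \<open>
  A linear functional on the root space is stored as its values \<open>f r\<close> at the simple roots, and \<open>reflect s f\<close> is its
  composition with the reflection in the simple root of \<open>s\<close>.
\<close>

definition reflect :: "'a \<Rightarrow> ('a \<Rightarrow> real) \<Rightarrow> 'a \<Rightarrow> real" where
  "reflect s f = (\<lambda>r. f r + weight s r * f s)"

text \<open>
  Generators act by involutions, so a letter and its formal inverse act in the same way.
\<close>

definition action :: "'a word \<Rightarrow> ('a \<Rightarrow> real) \<Rightarrow> 'a \<Rightarrow> real" where
  "action u = foldr (\<lambda>l. reflect (fst l)) u"

lemma m_refl: "s \<in> S \<Longrightarrow> m s s = 1"
  and m_sym: "s \<in> S \<Longrightarrow> t \<in> S \<Longrightarrow> m s t = m t s"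
  and m_ge_2: "s \<in> S \<Longrightarrow> t \<in> S \<Longrightarrow> s \<noteq> t \<Longrightarrow> 2 \<le> m s t"
  using coxeter by (auto simp: coxeter_matrix_def)

lemma weight_refl: "s \<in> S \<Longrightarrow> weight s s = -2"
  by (simp add: weight_def m_refl one_enat_def)

lemma reflect_same: "s \<in> S \<Longrightarrow> reflect s f s = - f s"
  by (simp add: reflect_def weight_refl)

lemma reflect_reflect: "s \<in> S \<Longrightarrow> reflect s (reflect s f) = f"
  by (rule ext) (simp add: reflect_def weight_refl algebra_simps)

lemma action_simps [simp]:
  "action [] f = f"
  "action (l # u) f = reflect (fst l) (action u f)"
  "action (u @ v) f = action u (action v f)"
  by (simp_all add: action_def)

lemma coxeter_relators_words: "coxeter_relators S m \<subseteq> words S"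
  by (auto simp: coxeter_relators_def words_def split: if_splits)

text \<open>
  The values at \<open>s\<close> and \<open>t\<close> evolve by themselves.  Alternately reflecting in \<open>t\<close> and \<open>s\<close> produces
  a sequence satisfying \<open>v\<^sub>i\<^sub>+\<^sub>1 + v\<^sub>i\<^sub>-\<^sub>1 = 2 cos \<theta> \<cdot> v\<^sub>i\<close>, whose solutions combine \<open>sin (i \<theta>)\<close> and \<open>sin ((i+1) \<theta>)\<close>;
  up to sign, the value at \<open>t\<close> is a term of even index and the value at \<open>s\<close> one of odd index.
\<close>

lemma rotation_orbit:
  assumes S: "s \<in> S" "t \<in> S" and m: "m s t = enat n"
  defines "\<theta> \<equiv> pi / real n"
  shows "sin \<theta> * ((reflect s \<circ> reflect t) ^^ j) f s
           = - (sin (2 * real j * \<theta>) * f t + sin ((2 * real j - 1) * \<theta>) * f s)"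
    and "sin \<theta> * ((reflect s \<circ> reflect t) ^^ j) f t
           = sin ((2 * real j + 1) * \<theta>) * f t + sin (2 * real j * \<theta>) * f s"
proof (induction j)
  case 0
  { case 1 show ?case by simp }
  { case 2 show ?case by simp }
next
  case (Suc j)
  let ?g = "((reflect s \<circ> reflect t) ^^ j) f"
  have c: "weight s t = 2 * cos \<theta>" "weight t s = 2 * cos \<theta>"
    using m m_sym[OF S] by (auto simp: weight_def \<theta>_def)
  have three_term: "sin (A + \<theta>) = 2 * cos \<theta> * sin A - sin (A - \<theta>)" for A
    by (simp add: sin_add sin_diff)
  have s1: "sin (2 * real (Suc j) * \<theta>)
      = 2 * cos \<theta> * sin ((2 * real j + 1) * \<theta>) - sin (2 * real j * \<theta>)"
    using three_term[of "(2 * real j + 1) * \<theta>"] by (simp add: algebra_simps)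
  have s2: "sin ((2 * real (Suc j) - 1) * \<theta>)
      = 2 * cos \<theta> * sin (2 * real j * \<theta>) - sin ((2 * real j - 1) * \<theta>)"
    using three_term[of "2 * real j * \<theta>"] by (simp add: algebra_simps)
  have s3: "sin ((2 * real (Suc j) + 1) * \<theta>)
      = 2 * cos \<theta> * sin (2 * real (Suc j) * \<theta>) - sin ((2 * real (Suc j) - 1) * \<theta>)"
    using three_term[of "2 * real (Suc j) * \<theta>"] by (simp add: algebra_simps)
  have s4: "sin ((2 * real j + 1) * \<theta>) = sin ((2 * real (Suc j) - 1) * \<theta>)"
    by (simp add: algebra_simps)
  have step: "((reflect s \<circ> reflect t) ^^ Suc j) f = reflect s (reflect t ?g)"
    by simp
  have gs: "reflect s (reflect t ?g) s = - (?g s + 2 * cos \<theta> * ?g t)"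
    using S by (simp add: reflect_same) (simp add: reflect_def c)
  have gt: "reflect s (reflect t ?g) t = - ?g t + 2 * cos \<theta> * (?g s + 2 * cos \<theta> * ?g t)"
    using S by (simp add: reflect_def c weight_refl)
  have s5: "sin \<theta> * (?g s + 2 * cos \<theta> * ?g t)
      = sin (2 * real (Suc j) * \<theta>) * f t + sin ((2 * real (Suc j) - 1) * \<theta>) * f s"
  proof -
    have "sin \<theta> * (?g s + 2 * cos \<theta> * ?g t) = sin \<theta> * ?g s + 2 * cos \<theta> * (sin \<theta> * ?g t)"
      by (simp add: algebra_simps)
    then show ?thesis
      unfolding Suc.IH s1 s2 by (simp add: algebra_simps)
  qed
  {
    case 1
    show ?case unfolding step gs mult_minus_right s5 ..
  next
    case 2
    have "sin \<theta> * (- ?g t + 2 * cos \<theta> * (?g s + 2 * cos \<theta> * ?g t))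
      = - (sin \<theta> * ?g t) + 2 * cos \<theta> * (sin \<theta> * (?g s + 2 * cos \<theta> * ?g t))"
      by (simp add: algebra_simps)
    also have "\<dots> = sin ((2 * real (Suc j) + 1) * \<theta>) * f t + sin (2 * real (Suc j) * \<theta>) * f s"
      unfolding Suc.IH s5 s3 s1 s2 s4 by (simp add: algebra_simps)
    finally show ?case unfolding step gt .
  }
qed

text \<open>
  The values at \<open>s\<close> and \<open>t\<close> return after \<open>n\<close> rotations by \<open>2\<theta> = 2\<pi>/n\<close>.  For any other \<open>r\<close> some combination
  \<open>f r - \<alpha> \<cdot> f s - \<beta> \<cdot> f t\<close> is invariant under both reflections, because the form is nondegenerate
  on the plane of \<open>s\<close> and \<open>t\<close>; so the value at \<open>r\<close> returns as well.
\<close>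

lemma rotation_power_id:
  assumes S: "s \<in> S" "t \<in> S" "s \<noteq> t" and m: "m s t = enat n"
  shows "((reflect s \<circ> reflect t) ^^ n) f = f"
proof
  fix r
  define \<theta> where "\<theta> = pi / real n"
  let ?R = "\<lambda>j. ((reflect s \<circ> reflect t) ^^ j) f"
  define c where "c = 2 * cos \<theta>"
  have n: "n \<ge> 2" using m_ge_2[OF S] m by (simp add: numeral_eq_enat)
  have w: "weight s t = c" "weight t s = c"
    using m m_sym[OF S(1,2)] by (auto simp: weight_def \<theta>_def c_def)
  have "0 < \<theta>" "\<theta> < pi"
    using n by (auto simp: \<theta>_def field_simps)
  then have sin: "sin \<theta> > 0" by (rule sin_gt_zero)
  have turn: "2 * real n * \<theta> = 2 * pi"
    using n by (simp add: \<theta>_def)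
  have "sin (2 * real n * \<theta>) = 0" "sin ((2 * real n - 1) * \<theta>) = - sin \<theta>"
    "sin ((2 * real n + 1) * \<theta>) = sin \<theta>"
    by (simp_all only: turn left_diff_distrib distrib_right mult_1 sin_diff sin_add
          sin_two_pi cos_two_pi)
  then have xy: "?R n s = f s" "?R n t = f t"
    using rotation_orbit[OF S(1,2) m, of n f, folded \<theta>_def] sin
    by auto
  have "4 - c\<^sup>2 = 4 * (sin \<theta>)\<^sup>2"
    by (simp add: c_def power_mult_distrib sin_squared_eq)
  then have c4: "4 - c\<^sup>2 > 0" using sin by simp
  \<comment> \<open>the solution of the two linear equations \<open>ab\<close> below, of determinant \<open>4 - c\<^sup>2\<close>, that express the invariance\<close>
  define \<alpha> where "\<alpha> = - (2 * weight s r + weight t r * c) / (4 - c\<^sup>2)"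
  define \<beta> where "\<beta> = - (2 * weight t r + weight s r * c) / (4 - c\<^sup>2)"
  have ab: "weight s r = \<beta> * c - 2 * \<alpha>" "weight t r = \<alpha> * c - 2 * \<beta>"
    using c4 by (simp_all add: \<alpha>_def \<beta>_def divide_simps) (simp_all add: algebra_simps power2_eq_square)
  define gap where "gap g = g r - \<alpha> * g s - \<beta> * g t" for g :: "'a \<Rightarrow> real"
  have "gap (reflect s g) = gap g" "gap (reflect t g) = gap g" for g
    using S by (simp_all add: gap_def reflect_def w weight_refl ab algebra_simps)
  then have "gap (?R j) = gap f" for j
    by (induction j) simp_all
  from this[of n] show "?R n r = f r"
    by (simp add: gap_def xy)
qed

lemma action_relator:
  assumes "u \<in> coxeter_relators S m"
  shows "action u f = f"
proof -
  obtain s t n where u: "u = concat (replicate n [(s, True), (t, True)])"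
    and st: "s \<in> S" "t \<in> S" "m s t = enat n"
    using assms by (auto simp: coxeter_relators_def)
  have "action u f = ((reflect s \<circ> reflect t) ^^ n) f"
    unfolding u by (induction n) simp_all
  also have "\<dots> = f"
  proof (cases "s = t")
    case True
    then have "n = 1" using st m_refl by (simp add: one_enat_def)
    with True st show ?thesis by (simp add: reflect_reflect)
  next
    case False
    with st show ?thesis by (simp add: rotation_power_id)
  qed
  finally show ?thesis .
qed

lemma action_respects_rel:
  assumes "(u, v) \<in> rel"
  shows "action u f = action v f"
  using assms
proof (induction arbitrary: f rule: pres_rel.induct)
  case (cancel u v s b)
  then show ?case by (simp add: reflect_reflect)
next
  case (relator u v r)
  then show ?case by (simp add: action_relator)
qed simp_all

lemma action_trivial: "trivial w \<Longrightarrow> action (letters w) f = f"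
  using action_respects_rel[of "letters w" "[]" f] by (simp add: trivial_def)

lemma trivial_Nil [simp]: "trivial []"
  by (simp add: trivial_def pres_rel.refl)

lemma trivial_cancel:
  assumes "set p \<subseteq> S" "x \<in> S" "set q \<subseteq> S"
  shows "trivial (p @ x # x # q) \<longleftrightarrow> trivial (p @ q)"
proof -
  have "[(x, True), (x, True)] \<in> coxeter_relators S m"
    using assms m_refl[of x]
    by (auto simp: coxeter_relators_def one_enat_def intro!: exI[of _ x] exI[of _ "1::nat"])
  then have "(letters (p @ x # x # q), letters (p @ q)) \<in> rel"
    using pres_rel.relator[of "letters p" S "letters q" "[(x, True), (x, True)]"] assms by simp
  then show ?thesis
    unfolding trivial_def by (meson pres_rel.sym pres_rel.trans)
qed

lemma action_rev:
  assumes "set p \<subseteq> S"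
  shows "action (letters (rev p)) (action (letters p) f) = f"
  using assms by (induction p arbitrary: f) (simp_all add: reflect_reflect)

lemma action_fixes_indicator:
  assumes "x \<notin> set w"
  shows "action (letters w) (\<lambda>r. if r = x then 1 else 0) = (\<lambda>r. if r = x then 1 else 0)"
  using assms by (induction w) (auto simp: reflect_def)

text \<open>
  The generators other than \<open>x\<close> fix the indicator function of \<open>x\<close>, so both ends of the word can be
  stripped.
\<close>

lemma trivial_around_fixes_indicator:
  assumes "trivial (p @ u @ q)" "set p \<subseteq> S" "x \<notin> set p" "x \<notin> set q"
  shows "action (letters u) (\<lambda>r. if r = x then 1 else 0) = (\<lambda>r. if r = x then 1 else 0)"
    (is "action _ ?e = _")
proof -
  have "action (letters p) (action (letters u) ?e) = ?e"
    using action_trivial[OF assms(1), of ?e] assms(4) by (simp add: action_fixes_indicator)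
  then have "action (letters u) ?e = action (letters (rev p)) ?e"
    using action_rev[OF assms(2), of "action (letters u) ?e"] by simp
  also have "\<dots> = ?e"
    using assms(3) by (intro action_fixes_indicator) simp
  finally show ?thesis .
qed

lemma single_occurrence_not_trivial:
  assumes "set w \<subseteq> S" "trivial w"
  shows "count_list w x \<noteq> 1"
proof
  assume "count_list w x = 1"
  then have "x \<in> set w" by (metis count_list_0_iff zero_neq_one)
  then obtain p q where w: "w = p @ x # q" "x \<notin> set p" by (meson split_list_first)
  then have "x \<notin> set q" using \<open>count_list w x = 1\<close> by (auto simp: count_list_0_iff)
  with w assms have "reflect x (\<lambda>r. if r = x then 1 else 0) = (\<lambda>r. if r = x then 1 else 0)"
    using trivial_around_fixes_indicator[of p "[x]" q x] by auto
  moreover have "x \<in> S" using w assms by auto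
  ultimately show False
    by (auto dest!: fun_cong[of _ _ x] simp: reflect_same)
qed

end

section \<open>Crossing pairs of letters\<close>

locale large_coxeter_presentation = coxeter_presentation +
  assumes m_ge_3: "x \<in> S \<Longrightarrow> y \<in> S \<Longrightarrow> x \<noteq> y \<Longrightarrow> 3 \<le> m x y"
begin

lemma weight_pos:
  assumes "x \<in> S" "y \<in> S" "x \<noteq> y"
  shows "weight x y > 0"
proof (cases "m x y")
  case (enat n)
  then have "n \<ge> 3" using m_ge_3[OF assms] by (simp add: numeral_eq_enat)
  then have "cos (pi / real n) > 0"
    by (intro cos_gt_zero) (auto simp: field_simps)
  with enat show ?thesis by (simp add: weight_def)
qed (simp add: weight_def)

text \<open>
  A reflection in \<open>t\<close> adds \<open>weight t r \<cdot> g t\<close> to the value at \<open>r\<close>, which is an increase as long as \<open>g t > 0\<close>.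
  It makes the value at \<open>t\<close> itself negative, which does no harm since \<open>t\<close> is never used again.
\<close>

lemma action_distinct_increases:
  assumes "distinct u" "set u \<subseteq> S - {x}" "x \<in> S" "g x = -1"
    and "\<And>r. r \<in> S \<Longrightarrow> r \<noteq> x \<Longrightarrow> g r > 0"
  shows "(\<forall>r\<in>S - {x} - set u. action (letters u) g r > 0)
           \<and> (if u = [] then action (letters u) g x = -1 else action (letters u) g x > -1)"
  using assms(1,2)
proof (induction u)
  case Nil
  then show ?case using assms by simp
next
  case (Cons t u)
  let ?h = "action (letters u) g"
  have IH: "\<And>r. r \<in> S - {x} - set u \<Longrightarrow> ?h r > 0" "?h x \<ge> -1"
    using Cons by (auto split: if_splits)
  have t: "t \<in> S" "t \<noteq> x" "?h t > 0" using Cons.prems IH(1)[of t] by auto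
  have inc: "reflect t ?h r > ?h r" if "r \<in> S" "r \<noteq> t" for r
    using that t weight_pos[of t r] by (simp add: reflect_def)
  have "reflect t ?h r > 0" if "r \<in> S - {x} - set (t # u)" for r
    using inc[of r] IH(1)[of r] that by force
  moreover have "reflect t ?h x > -1"
    using inc[of x] IH(2) t assms(3) by auto
  ultimately show ?case by simp
qed

text \<open>
  If the word were trivial, the word \<open>u\<close> would fix the reflection in \<open>x\<close> of the indicator function of \<open>x\<close>.  This
  function is \<open>-1\<close> at \<open>x\<close> and positive elsewhere on \<open>S\<close>, so \<open>u\<close> raises its value at \<open>x\<close>.
\<close>

lemma crossing_not_trivial:
  assumes "set p \<subseteq> S" "x \<in> S" "set u \<subseteq> S" "distinct u" "u \<noteq> []"
    and "x \<notin> set p" "x \<notin> set u" "x \<notin> set q"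
  shows "\<not> trivial (p @ x # u @ x # q)"
proof
  let ?e = "\<lambda>r. if r = x then 1 else (0::real)"
  assume "trivial (p @ x # u @ x # q)"
  then have "reflect x (action (letters u) (reflect x ?e)) = ?e"
    using trivial_around_fixes_indicator[of p "x # u @ [x]" q x] assms by simp
  then have "action (letters u) (reflect x ?e) = reflect x ?e"
    using reflect_reflect[OF assms(2)] by metis
  moreover have "action (letters u) (reflect x ?e) x > -1"
    using action_distinct_increases[of u x "reflect x ?e"] assms weight_pos[of x]
    by (auto simp: reflect_same reflect_def weight_refl)
  ultimately show False
    using assms(2) by (simp add: reflect_same)
qed

section \<open>Reading a trivial word with a stack\<close>

text \<open>
  The words that complete the pairing once the open letters \<open>st\<close> (most recent first) have been read,
  with \<open>U\<close> the letters that are still unused.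
\<close>

definition closings :: "'a set \<Rightarrow> 'a list \<Rightarrow> nat \<Rightarrow> 'a list set" where
  "closings U st k = {w. length w = k \<and> set w \<subseteq> U \<union> set st \<and> (\<forall>x\<in>set st. count_list w x = 1)
     \<and> (\<forall>x\<in>U. count_list w x \<in> {0, 2}) \<and> trivial (rev st @ w)}"

text \<open>
  A letter that is open but not on top of the stack would close a pair around the nonempty word of
  distinct letters above it; this is excluded by \<open>crossing_not_trivial\<close>.  A letter that equals the top
  cancels with it.
\<close>

lemma Cons_in_closings_iff:
  assumes "U \<subseteq> S" "set st \<subseteq> S" "distinct st" "U \<inter> set st = {}"
  shows "x # w \<in> closings U st (Suc k) \<longleftrightarrow>
    (\<exists>st'. st = x # st' \<and> w \<in> closings U st' k) \<or> (x \<in> U \<and> w \<in> closings (U - {x}) (x # st) k)"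
    (is "?L \<longleftrightarrow> ?pop \<or> ?push")
proof (intro iffI)
  assume L: ?L
  then have "x \<in> U \<or> x \<in> set st" by (auto simp: closings_def)
  then show "?pop \<or> ?push"
  proof
    assume "x \<in> U"
    then have "?push" using L assms by (auto simp: closings_def split: if_splits)
    then show ?thesis ..
  next
    assume x: "x \<in> set st"
    have w: "x \<notin> set w" using L x by (auto simp: closings_def count_list_0_iff)
    obtain us vs where st: "st = us @ x # vs" using x by (meson split_list)
    have "us = []"
    proof (rule ccontr)
      assume "us \<noteq> []"
      with st assms w have "\<not> trivial (rev vs @ x # rev us @ x # w)"
        by (intro crossing_not_trivial) auto
      moreover have "trivial (rev vs @ x # rev us @ x # w)"
        using L st by (simp add: closings_def)
      ultimately show False by blast
    qed
    with st have st: "st = x # vs" by simp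
    have "trivial (rev vs @ w)"
      using L st assms trivial_cancel[of "rev vs" x w] by (auto simp: closings_def)
    then have ?pop using L st w assms by (auto simp: closings_def split: if_splits)
    then show ?thesis ..
  qed
next
  assume "?pop \<or> ?push"
  then show ?L
  proof
    assume ?pop
    then obtain vs where st: "st = x # vs" and w: "w \<in> closings U vs k" by blast
    have "x \<notin> set w" using st w assms by (auto simp: closings_def)
    moreover have "trivial (rev st @ x # w)"
      using w st assms trivial_cancel[of "rev vs" x w] by (auto simp: closings_def)
    ultimately show ?L
      using w st assms by (auto simp: closings_def count_list_0_iff)
  next
    assume ?push
    then show ?L using assms by (auto simp: closings_def)
  qed
qed

end

text \<open>
  Only the number \<open>n\<close> of unused letters and the height \<open>h\<close> of the stack matter for the number of completions of
  length \<open>k\<close>.  A pop leaves no choice, a push has \<open>n\<close> choices.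
\<close>

fun closing_count :: "nat \<Rightarrow> nat \<Rightarrow> nat \<Rightarrow> nat" where
  "closing_count n 0 h = (if h = 0 then 1 else 0)"
| "closing_count n (Suc k) h =
     (case h of 0 \<Rightarrow> 0 | Suc h' \<Rightarrow> closing_count n k h') + n * closing_count (n - 1) k (Suc h)"

context large_coxeter_presentation
begin

lemma finite_closings: "finite U \<Longrightarrow> finite (closings U st k)"
  by (rule finite_subset[OF _ finite_lists_length_eq[of "U \<union> set st" k]])
     (auto simp: closings_def)

lemma card_closings:
  assumes "finite U" "U \<subseteq> S" "set st \<subseteq> S" "distinct st" "U \<inter> set st = {}"
  shows "card (closings U st k) = closing_count (card U) k (length st)"
  using assms
proof (induction k arbitrary: U st)
  case 0
  have "closings U st 0 = (if st = [] then {[]} else {})"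
    by (auto simp: closings_def)
  then show ?case by simp
next
  case (Suc k)
  let ?pop = "case st of [] \<Rightarrow> {} | t # st' \<Rightarrow> (#) t ` closings U st' k"
  let ?push = "\<Union>x\<in>U. (#) x ` closings (U - {x}) (x # st) k"
  have "w \<in> closings U st (Suc k) \<longleftrightarrow> w \<in> ?pop \<union> ?push" for w
  proof (cases w)
    case Nil
    then show ?thesis by (auto simp: closings_def split: list.split)
  next
    case (Cons x v)
    then show ?thesis
      using Cons_in_closings_iff[OF Suc.prems(2-5), of x v k] by (auto split: list.split)
  qed
  then have split: "closings U st (Suc k) = ?pop \<union> ?push" by blast
  have pop: "card ?pop = (case length st of 0 \<Rightarrow> 0 | Suc h' \<Rightarrow> closing_count (card U) k h')"
    using Suc by (auto split: list.split simp: card_image)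
  have "card ?push = (\<Sum>x\<in>U. card ((#) x ` closings (U - {x}) (x # st) k))"
    using Suc.prems by (intro card_UN_disjoint) (auto simp: finite_closings)
  also have "\<dots> = (\<Sum>x\<in>U. closing_count (card U - 1) k (Suc (length st)))"
  proof (rule sum.cong)
    fix x assume x: "x \<in> U"
    then have "card (closings (U - {x}) (x # st) k)
        = closing_count (card (U - {x})) k (length (x # st))"
      using Suc.prems by (intro Suc.IH) auto
    with x Suc.prems show "card ((#) x ` closings (U - {x}) (x # st) k)
        = closing_count (card U - 1) k (Suc (length st))"
      by (simp add: card_image)
  qed simp
  finally have push: "card ?push = card U * closing_count (card U - 1) k (Suc (length st))"
    by simp
  have "?pop \<inter> ?push = {}" using Suc.prems by (auto split: list.split)
  moreover have "finite ?pop" "finite ?push"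
    using Suc.prems by (auto simp: finite_closings split: list.split)
  ultimately show ?case
    using card_Un_disjoint[of ?pop ?push] by (simp add: split pop push)
qed

end

section \<open>Ballot numbers\<close>

lemma closing_count_odd: "odd (k + h) \<Longrightarrow> closing_count n k h = 0"
  by (induction n k h rule: closing_count.induct) (auto split: nat.split simp: odd_pos)

lemma closing_count_short: "k < h \<Longrightarrow> closing_count n k h = 0"
  by (induction n k h rule: closing_count.induct) (auto split: nat.split)

text \<open>
  The number of paths with steps \<open>1\<close> and \<open>-1\<close> that lead from height \<open>h\<close> to \<open>0\<close> without becoming negative
  and have \<open>p\<close> upward steps; for \<open>h = 0\<close> this is the Catalan number.
\<close>

definition ballot :: "nat \<Rightarrow> nat \<Rightarrow> real" where
  "ballot p h = real (h + 1) / real (p + h + 1) * real ((2 * p + h) choose p)"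

lemma ballot_0 [simp]: "ballot 0 h = 1"
  by (simp add: ballot_def)

text \<open>
  The first step of such a path goes down (unless \<open>h = 0\<close>) or up.
\<close>

lemma ballot_Suc:
  "ballot (Suc p) h = (case h of 0 \<Rightarrow> 0 | Suc h' \<Rightarrow> ballot (Suc p) h') + ballot p (Suc h)"
proof -
  define X where "X = real ((2 * p + h + 1) choose p)"
  define Y where "Y = real ((2 * p + h + 1) choose Suc p)"
  have "Suc p * ((2 * p + h + 1) choose Suc p) = (p + h + 1) * ((2 * p + h + 1) choose p)"
    using binomial_absorb_comp[of "2 * p + h + 1" p] binomial_absorption[of p "2 * p + h + 1"]
    by simp
  then have "real (Suc p * ((2 * p + h + 1) choose Suc p)) = real ((p + h + 1) * ((2 * p + h + 1) choose p))"
    by simp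
  then have Y: "Y = real (p + h + 1) / real (p + 1) * X"
    by (simp add: X_def Y_def field_simps)
  have "ballot (Suc p) h = real (h + 1) / real (p + h + 2) * (X + Y)"
    by (simp add: ballot_def X_def Y_def)
  also have "\<dots> = real h / real (p + h + 1) * Y + real (h + 2) / real (p + h + 2) * X"
    unfolding Y by (simp add: divide_simps) (simp add: algebra_simps)
  also have "real h / real (p + h + 1) * Y = (case h of 0 \<Rightarrow> 0 | Suc h' \<Rightarrow> ballot (Suc p) h')"
    by (cases h) (simp_all add: ballot_def Y_def)
  also have "real (h + 2) / real (p + h + 2) * X = ballot p (Suc h)"
    by (simp add: ballot_def X_def)
  finally show ?thesis .
qed

text \<open>
  A completion chooses a path of stack heights and, independently, an injective sequence of new
  letters for its pushes.
\<close>

lemma closing_count_ballot: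
  "real (closing_count n (2 * p + h) h) = ballot p h * (\<Prod>i<p. real n - real i)"
proof (induction "2 * p + h" arbitrary: n p h)
  case 0
  then show ?case by simp
next
  case (Suc k)
  show ?case
  proof (cases p)
    case 0
    with Suc.hyps(2) have h: "h = Suc k" by simp
    with Suc.hyps(1)[of 0 k n] 0 show ?thesis by (simp add: closing_count_short)
  next
    case p: (Suc p')
    have k: "k = 2 * p' + Suc h" using Suc.hyps(2) p by simp
    have pop: "real (case h of 0 \<Rightarrow> 0 | Suc h' \<Rightarrow> closing_count n k h')
        = (case h of 0 \<Rightarrow> 0 | Suc h' \<Rightarrow> ballot p h') * (\<Prod>i<p. real n - real i)"
    proof (cases h)
      case (Suc h')
      with Suc.hyps(1)[of p h' n] k p show ?thesis by simp
    qed simp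
    have "real (n * closing_count (n - 1) k (Suc h))
        = ballot p' (Suc h) * (real n * (\<Prod>i<p'. real (n - 1) - real i))"
      using Suc.hyps(1)[of p' "Suc h" "n - 1"] k by simp
    also have "real n * (\<Prod>i<p'. real (n - 1) - real i) = (\<Prod>i<p. real n - real i)"
      by (cases n) (simp_all add: p prod.lessThan_Suc_shift del: prod.lessThan_Suc)
    finally have push: "real (n * closing_count (n - 1) k (Suc h))
        = ballot p' (Suc h) * (\<Prod>i<p. real n - real i)" .
    have "real (closing_count n (Suc k) h)
        = ((case h of 0 \<Rightarrow> 0 | Suc h' \<Rightarrow> ballot p h') + ballot p' (Suc h)) * (\<Prod>i<p. real n - real i)"
      using pop push by (simp add: algebra_simps)
    moreover have "ballot p h = (case h of 0 \<Rightarrow> 0 | Suc h' \<Rightarrow> ballot p h') + ballot p' (Suc h)"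
      unfolding p by (rule ballot_Suc)
    ultimately show ?thesis
      unfolding Suc.hyps(2)[symmetric] by simp
  qed
qed

lemma sqrt_power_even: "sqrt (real N) ^ (2 * n) = real N ^ n"
  by (simp add: power_mult)

lemma closing_count_limit:
  "(\<lambda>N. real (closing_count N k 0) / sqrt (real N) ^ k)
     \<longlonglongrightarrow> (if odd k then 0 else real (k choose (k div 2)) / real (k div 2 + 1))"
proof (cases "odd k")
  case True
  then show ?thesis by (simp add: closing_count_odd)
next
  case False
  then obtain n where k: "k = 2 * n" by (auto elim: evenE)
  have "(\<lambda>N. ballot n 0 * (\<Prod>i<n. 1 - real i / real N)) \<longlonglongrightarrow> ballot n 0 * (\<Prod>i<n. 1 - 0)"
    by (intro tendsto_intros tendsto_prod lim_const_over_n)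
  moreover have "\<forall>\<^sub>F N in sequentially. ballot n 0 * (\<Prod>i<n. 1 - real i / real N)
      = real (closing_count N k 0) / sqrt (real N) ^ k"
    using eventually_gt_at_top[of 0]
  proof eventually_elim
    case (elim N)
    have "real (closing_count N k 0) / sqrt (real N) ^ k
        = ballot n 0 * ((\<Prod>i<n. real N - real i) / (\<Prod>i<n. real N))"
      using closing_count_ballot[of N n 0] by (simp add: k sqrt_power_even)
    also have "(\<Prod>i<n. real N - real i) / (\<Prod>i<n. real N) = (\<Prod>i<n. 1 - real i / real N)"
      unfolding prod_dividef[symmetric] using elim by (intro prod.cong) (auto simp: field_simps)
    finally show ?case by simp
  qed
  ultimately have "(\<lambda>N. real (closing_count N k 0) / sqrt (real N) ^ k)
      \<longlonglongrightarrow> ballot n 0 * (\<Prod>i<n. 1 - 0)"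
    by (rule Lim_transform_eventually)
  then show ?thesis by (simp add: k ballot_def)
qed

section \<open>Words with few letters\<close>

definition few_letters :: "'a set \<Rightarrow> nat \<Rightarrow> 'a list set" where
  "few_letters U k = {w. length w = k \<and> set w \<subseteq> U \<and> 2 * card (set w) < k}"

text \<open>
  Such a word is determined by a list \<open>l\<close> of \<open>d\<close> letters that contains all of its letters, together with
  the position in \<open>l\<close> of each entry.
\<close>

lemma card_few_letters:
  assumes "finite U" "k > 0" and d: "d = (k - 1) div 2"
  shows "card (few_letters U k) \<le> card U ^ d * d ^ k"
proof -
  let ?L = "{l. set l \<subseteq> U \<and> length l = d}" and ?V = "{v. set v \<subseteq> {..<d} \<and> length v = k}"
  have fin: "finite ?L" "finite ?V"
    using assms by (auto intro: finite_lists_length_eq)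
  have "few_letters U k \<subseteq> (\<lambda>(l, v). map ((!) l) v) ` (?L \<times> ?V)"
  proof
    fix w assume "w \<in> few_letters U k"
    then have w: "length w = k" "set w \<subseteq> U" "card (set w) \<le> d"
      using d by (auto simp: few_letters_def)
    then obtain x where x: "x \<in> set w" using assms(2) by (cases w) auto
    obtain l0 where l0: "set l0 = set w" "length l0 = card (set w)"
      using finite_distinct_list[of "set w"] distinct_card by force
    \<comment> \<open>repeating a letter of \<open>w\<close> brings the list to length exactly \<open>d\<close>\<close>
    define l where "l = l0 @ replicate (d - card (set w)) x"
    have l: "set l = set w" "length l = d"
      using l0 w x by (auto simp: l_def)
    have "\<exists>i<d. l ! i = y" if "y \<in> set w" for y
      using that l by (metis in_set_conv_nth)
    then obtain \<iota> where \<iota>: "\<And>y. y \<in> set w \<Longrightarrow> \<iota> y < d \<and> l ! \<iota> y = y" by metis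
    have "w = map ((!) l) (map \<iota> w)"
      using \<iota> by (simp add: map_idI)
    moreover have "l \<in> ?L" "map \<iota> w \<in> ?V" using l w \<iota> by auto
    ultimately show "w \<in> (\<lambda>(l, v). map ((!) l) v) ` (?L \<times> ?V)"
      by (intro image_eqI[of _ _ "(l, map \<iota> w)"]) simp_all
  qed
  then have "card (few_letters U k) \<le> card (?L \<times> ?V)"
    using fin by (intro surj_card_le) auto
  also have "\<dots> = card U ^ d * d ^ k"
    using assms by (simp add: card_cartesian_product card_lists_length_eq)
  finally show ?thesis .
qed

text \<open>
  There are \<open>O(N^d)\<close> such words with \<open>2 d + 1 \<le> k\<close>, so at least one factor \<open>\<surd>N\<close> of the normalisation is
  left over.
\<close>

lemma few_letters_negligible:
  assumes "finite U" "card U > 0"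
  shows "real (card (few_letters U k)) / sqrt (real (card U)) ^ k
           \<le> real (k ^ k) / sqrt (real (card U))"
proof (cases "k = 0")
  case False
  define d where "d = (k - 1) div 2"
  let ?r = "sqrt (real (card U))"
  have r: "?r \<ge> 1" using assms by simp
  have "card (few_letters U k) \<le> card U ^ d * d ^ k"
    using card_few_letters[OF assms(1) _ d_def] False by simp
  also have "\<dots> \<le> card U ^ d * k ^ k"
    by (intro mult_le_mono2 power_mono) (auto simp: d_def)
  finally have "card (few_letters U k) \<le> card U ^ d * k ^ k" .
  then have "real (card (few_letters U k)) \<le> real (card U ^ d * k ^ k)"
    by (rule of_nat_mono)
  also have "\<dots> = real (k ^ k) * ?r ^ (2 * d)"
    unfolding sqrt_power_even by simp
  finally have "real (card (few_letters U k)) * ?r \<le> real (k ^ k) * ?r ^ (2 * d) * ?r"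
    using r by (intro mult_right_mono) auto
  also have "\<dots> = real (k ^ k) * ?r ^ (2 * d + 1)" by simp
  also have "\<dots> \<le> real (k ^ k) * ?r ^ k"
    using r False by (intro mult_left_mono power_increasing) (auto simp: d_def)
  finally show ?thesis
    using assms by (simp add: field_simps)
qed (simp add: few_letters_def)

section \<open>The trace as a count of trivial words\<close>

context coxeter_presentation
begin

definition trivial_words :: "'a set \<Rightarrow> nat \<Rightarrow> 'a list set" where
  "trivial_words U k = {w. set w \<subseteq> U \<and> length w = k \<and> trivial w}"

lemma finite_trivial_words: "finite U \<Longrightarrow> finite (trivial_words U k)"
  by (rule finite_subset[OF _ finite_lists_length_eq[of U k]]) (auto simp: trivial_words_def)

lemma power_generator_sum:
  fixes c :: complex
  assumes "finite U" "U \<subseteq> S"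
  defines "A \<equiv> group_algebra (coxeter_group S m)"
  shows "(c \<odot>\<^bsub>A\<^esub> (\<Oplus>\<^bsub>A\<^esub>t\<in>U. delta (coxeter_gen S m t))) [^]\<^bsub>A\<^esub> (k::nat)
           = (\<lambda>z. \<Sum>w | set w \<subseteq> U \<and> length w = k. c ^ k * delta (rel `` {letters w}) z)"
proof (induction k)
  case 0
  have "{w. set w \<subseteq> U \<and> w = []} = {[]}" by auto
  then show ?case
    by (simp add: nat_pow_def A_def group_algebra_def coxeter_group_def presented_group_def)
next
  case (Suc k)
  let ?L = "\<lambda>k. {w. set w \<subseteq> U \<and> length w = k}"
  have "coxeter_gen S m t \<in> carrier (coxeter_group S m)" if "t \<in> U" for t
    using that assms(2)
    by (auto simp: coxeter_gen_def coxeter_group_def presented_group_def words_def intro!: quotientI)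
  then have sum: "c \<odot>\<^bsub>A\<^esub> (\<Oplus>\<^bsub>A\<^esub>t\<in>U. delta (coxeter_gen S m t))
      = (\<lambda>z. \<Sum>t\<in>U. c * delta (coxeter_gen S m t) z)"
    unfolding A_def using assms(1)
    by (subst finsum_delta) (auto simp: group_algebra_def sum_distrib_left)
  have "(c \<odot>\<^bsub>A\<^esub> (\<Oplus>\<^bsub>A\<^esub>t\<in>U. delta (coxeter_gen S m t))) [^]\<^bsub>A\<^esub> Suc k
      = (\<lambda>z. \<Sum>w\<in>?L k. c ^ k * delta (rel `` {letters w}) z)
          \<otimes>\<^bsub>A\<^esub> (\<lambda>z. \<Sum>t\<in>U. c * delta (coxeter_gen S m t) z)"
    using Suc.IH by (simp add: nat_pow_def sum)
  also have "\<dots> = (\<lambda>z. \<Sum>(w, t)\<in>?L k \<times> U. c ^ k * c *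
      delta (rel `` {letters w} \<otimes>\<^bsub>coxeter_group S m\<^esub> coxeter_gen S m t) z)"
    unfolding A_def using assms(1) by (intro convolution_delta_sums finite_lists_length_eq)
  also have "\<dots> = (\<lambda>z. \<Sum>(w, t)\<in>?L k \<times> U. c ^ k * c * delta (rel `` {letters (w @ [t])}) z)"
  proof (rule ext)
    fix z
    have "rel `` {letters w} \<otimes>\<^bsub>coxeter_group S m\<^esub> coxeter_gen S m t = rel `` {letters (w @ [t])}"
      if "set w \<subseteq> U" "t \<in> U" for w t
      using presented_group_mult_class[of "letters w" S "letters [t]" "coxeter_relators S m"]
        that assms(2) coxeter_relators_words by (auto simp: coxeter_group_def coxeter_gen_def)
    then show "(\<Sum>(w, t)\<in>?L k \<times> U. c ^ k * c *
          delta (rel `` {letters w} \<otimes>\<^bsub>coxeter_group S m\<^esub> coxeter_gen S m t) z)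
        = (\<Sum>(w, t)\<in>?L k \<times> U. c ^ k * c * delta (rel `` {letters (w @ [t])}) z)"
      by (intro sum.cong HOL.refl) auto
  qed
  also have "\<dots> = (\<lambda>z. \<Sum>w\<in>?L (Suc k). c ^ Suc k * delta (rel `` {letters w}) z)"
  proof
    fix z
    show "(\<Sum>(w, t)\<in>?L k \<times> U. c ^ k * c * delta (rel `` {letters (w @ [t])}) z)
        = (\<Sum>w\<in>?L (Suc k). c ^ Suc k * delta (rel `` {letters w}) z)"
    proof (rule sum.reindex_bij_witness[of _ "\<lambda>w. (butlast w, last w)" "\<lambda>(w, t). w @ [t]"])
      fix w assume w: "w \<in> ?L (Suc k)"
      then have "w \<noteq> []" by auto
      then show "(case (butlast w, last w) of (w, t) \<Rightarrow> w @ [t]) = w" by simp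
      show "(butlast w, last w) \<in> ?L k \<times> U"
        using w \<open>w \<noteq> []\<close> by (auto dest: in_set_butlastD last_in_set)
    qed (auto simp: mult_ac)
  qed
  finally show ?case .
qed

lemma trace_power_generator_sum:
  fixes c :: complex
  assumes "finite U" "U \<subseteq> S"
  defines "A \<equiv> group_algebra (coxeter_group S m)"
  shows "canonical_trace (coxeter_group S m)
           ((c \<odot>\<^bsub>A\<^esub> (\<Oplus>\<^bsub>A\<^esub>t\<in>U. delta (coxeter_gen S m t))) [^]\<^bsub>A\<^esub> (k::nat))
         = c ^ k * of_nat (card (trivial_words U k))"
proof -
  let ?L = "{w. set w \<subseteq> U \<and> length w = k}"
  have "delta (rel `` {letters w}) (rel `` {[]}) = (if trivial w then 1 else 0)" if "w \<in> ?L" for w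
  proof -
    have "letters w \<in> words S" using that assms(2) by auto
    then show ?thesis
      using eq_equiv_class_iff[OF equiv_pres_rel[OF coxeter_relators_words], of "letters w" "[]"]
      by (auto simp: delta_def trivial_def)
  qed
  then have "(\<Sum>w\<in>?L. c ^ k * delta (rel `` {letters w}) (rel `` {[]}))
      = (\<Sum>w\<in>?L. if trivial w then c ^ k else 0)"
    by (intro sum.cong) auto
  also have "\<dots> = (\<Sum>w\<in>trivial_words U k. c ^ k)"
    using assms(1) by (intro sum.mono_neutral_cong_right finite_lists_length_eq)
      (auto simp: trivial_words_def)
  finally show ?thesis
    unfolding A_def power_generator_sum[OF assms(1,2)]
    by (simp add: canonical_trace_def coxeter_group_def presented_group_def)
qed

end

section \<open>The limit\<close>

context large_coxeter_presentation
begin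

text \<open>
  Every letter of a trivial word occurs at least twice, so by counting positions a letter that occurs three
  times forces the word to use fewer than \<open>k/2\<close> letters.
\<close>

lemma trivial_words_split:
  assumes "U \<subseteq> S"
  shows "closings U [] k \<subseteq> trivial_words U k"
    and "trivial_words U k \<subseteq> closings U [] k \<union> few_letters U k"
proof -
  show "closings U [] k \<subseteq> trivial_words U k"
    by (auto simp: closings_def trivial_words_def)
  show "trivial_words U k \<subseteq> closings U [] k \<union> few_letters U k"
  proof
    fix w assume w: "w \<in> trivial_words U k"
    have ge2: "2 \<le> count_list w x" if "x \<in> set w" for x
    proof -
      have "count_list w x \<noteq> 0" using that by (simp add: count_list_0_iff)
      moreover have "count_list w x \<noteq> 1"
        using w assms by (intro single_occurrence_not_trivial) (auto simp: trivial_words_def)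
      ultimately show ?thesis by simp
    qed
    show "w \<in> closings U [] k \<union> few_letters U k"
    proof (cases "\<exists>x\<in>set w. 2 < count_list w x")
      case True
      then have "(\<Sum>x\<in>set w. 2) < (\<Sum>x\<in>set w. count_list w x)"
        using ge2 by (intro sum_strict_mono_ex1) auto
      then have "2 * card (set w) < k"
        using w sum_count_set[of w "set w"] by (simp add: trivial_words_def)
      with w show ?thesis by (simp add: trivial_words_def few_letters_def)
    next
      case False
      then have "count_list w x \<in> {0, 2}" for x
        using ge2[of x] by (cases "x \<in> set w") (auto simp: count_list_0_iff)
      with w show ?thesis by (auto simp: trivial_words_def closings_def)
    qed
  qed
qed

lemma card_trivial_words:
  assumes "finite U" "U \<subseteq> S"
  shows "closing_count (card U) k 0 \<le> card (trivial_words U k)"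
    and "card (trivial_words U k) \<le> closing_count (card U) k 0 + card (few_letters U k)"
proof -
  have "finite (few_letters U k)"
    by (rule finite_subset[OF _ finite_lists_length_eq[OF assms(1), of k]])
       (auto simp: few_letters_def)
  moreover have "card (closings U [] k) = closing_count (card U) k 0"
    using card_closings[of U "[]" k] assms by simp
  ultimately show "closing_count (card U) k 0 \<le> card (trivial_words U k)"
    and "card (trivial_words U k) \<le> closing_count (card U) k 0 + card (few_letters U k)"
    using trivial_words_split[OF assms(2), of k] finite_trivial_words[OF assms(1), of k]
      card_mono[of "trivial_words U k" "closings U [] k"]
      card_mono[of "closings U [] k \<union> few_letters U k" "trivial_words U k"]
      card_Un_le[of "closings U [] k" "few_letters U k"] finite_closings[OF assms(1), of "[]" k]
    by auto
qed

lemma trivial_words_limit: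
  assumes "\<And>N. finite (U N)" "\<And>N. U N \<subseteq> S" "\<And>N. card (U N) = N"
  shows "(\<lambda>N. real (card (trivial_words (U N) k)) / sqrt (real N) ^ k)
           \<longlonglongrightarrow> (if odd k then 0 else real (k choose (k div 2)) / real (k div 2 + 1))"
proof (rule tendsto_sandwich)
  let ?c = "\<lambda>N. real (closing_count N k 0) / sqrt (real N) ^ k"
  show "\<forall>\<^sub>F N in sequentially. ?c N \<le> real (card (trivial_words (U N) k)) / sqrt (real N) ^ k"
    using card_trivial_words(1)[OF assms(1,2)] assms(3)
    by (intro always_eventually allI divide_right_mono) auto
  show "\<forall>\<^sub>F N in sequentially. real (card (trivial_words (U N) k)) / sqrt (real N) ^ k
          \<le> ?c N + real (k ^ k) / sqrt (real N)"
    using eventually_gt_at_top[of 0]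
  proof eventually_elim
    case (elim N)
    have "real (card (trivial_words (U N) k))
        \<le> real (closing_count N k 0) + real (card (few_letters (U N) k))"
      using card_trivial_words(2)[OF assms(1,2), of N k] assms(3) by simp
    then have "real (card (trivial_words (U N) k)) / sqrt (real N) ^ k
        \<le> ?c N + real (card (few_letters (U N) k)) / sqrt (real N) ^ k"
      unfolding add_divide_distrib[symmetric] by (intro divide_right_mono) auto
    with few_letters_negligible[OF assms(1), of N k] elim assms(3) show ?case by simp
  qed
  show "?c \<longlonglongrightarrow> (if odd k then 0 else real (k choose (k div 2)) / real (k div 2 + 1))"
    by (rule closing_count_limit)
  have "(\<lambda>N. real (k ^ k) / sqrt (real N)) \<longlonglongrightarrow> 0"
    by (intro real_tendsto_divide_at_top[OF tendsto_const]
          filterlim_compose[OF sqrt_at_top filterlim_real_sequentially])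
  from tendsto_add[OF closing_count_limit[of k] this]
  show "(\<lambda>N. ?c N + real (k ^ k) / sqrt (real N))
      \<longlonglongrightarrow> (if odd k then 0 else real (k choose (k div 2)) / real (k div 2 + 1))"
    by simp
qed

end

theorem theorem1:
  fixes S :: "'a set" and m :: "'a \<Rightarrow> 'a \<Rightarrow> enat" and s :: "nat \<Rightarrow> 'a" and k :: nat
  assumes "bij_betw s {1..} S"
    and "coxeter_matrix S m"
    and "\<forall>x\<in>S. \<forall>y\<in>S. x \<noteq> y \<longrightarrow> m x y \<ge> 3"
  defines "G \<equiv> coxeter_group S m"
  defines "A \<equiv> group_algebra G"
  shows "(\<lambda>N. canonical_trace G
            (((1 / complex_of_real (sqrt (real N))) \<odot>\<^bsub>A\<^esub>
               (\<Oplus>\<^bsub>A\<^esub>i\<in>{1..N}. delta (coxeter_gen S m (s i)))) [^]\<^bsub>A\<^esub> k))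
         \<longlonglongrightarrow> (if odd k then 0
             else let n = k div 2 in of_nat ((2 * n) choose n) / of_nat (n + 1))"
proof -
  interpret large_coxeter_presentation S m
    using assms(2,3) by unfold_locales auto
  define U where "U N = s ` {1..N}" for N :: nat
  have inj: "inj_on s {1..N}" for N
    using assms(1) by (auto simp: bij_betw_def intro: inj_on_subset)
  have fin: "finite (U N)" and sub: "U N \<subseteq> S" and card: "card (U N) = N" for N
    using assms(1) card_image[OF inj, of N] by (auto simp: U_def bij_betw_def)
  interpret abelian_monoid A
    unfolding A_def by (rule group_algebra_abelian_monoid)
  have gen: "delta (coxeter_gen S m t) \<in> carrier A" if "t \<in> S" for t
    using that
    by (auto simp: A_def G_def group_algebra_def delta_def coxeter_gen_def coxeter_group_def
          presented_group_def words_def intro!: quotientI)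
  have "(\<Oplus>\<^bsub>A\<^esub>i\<in>{1..N}. delta (coxeter_gen S m (s i))) = (\<Oplus>\<^bsub>A\<^esub>t\<in>U N. delta (coxeter_gen S m t))"
    for N
    unfolding U_def using gen sub[of N] inj[of N]
    by (intro finsum_reindex[symmetric]) (auto simp: U_def)
  then have trace: "canonical_trace G
            (((1 / complex_of_real (sqrt (real N))) \<odot>\<^bsub>A\<^esub>
               (\<Oplus>\<^bsub>A\<^esub>i\<in>{1..N}. delta (coxeter_gen S m (s i)))) [^]\<^bsub>A\<^esub> k)
      = complex_of_real (real (card (trivial_words (U N) k)) / sqrt (real N) ^ k)" for N
    unfolding A_def G_def
    by (simp add: trace_power_generator_sum[OF fin sub] power_divide)
  have limit: "(if odd k then 0
             else let n = k div 2 in of_nat ((2 * n) choose n) / of_nat (n + 1))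
      = complex_of_real (if odd k then 0 else real (k choose (k div 2)) / real (k div 2 + 1))"
    by (auto simp: Let_def)
  show ?thesis
    unfolding trace limit
    by (intro tendsto_of_real trivial_words_limit fin sub card)
qed

end
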